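(* Let $\chi_1$ and $\chi_2$ be nontrivial primitive Dirichlet characters modulo $q_1$ and $q_2$ with $\chi_1\chi_2(-1)=1$, and let $c$ be a positive integer with $q_1q_2\mid c$. For every $\varepsilon>0$, \[\sum_{\substack{a\bmod c\\(a,c)=1}}\lvert S_{\chi_1,\chi_2}(a,c)\rvert^2\ll_\varepsilon q_1c^{2+\varepsilon},\] where the implied constant depends only on $\varepsilon$.
   Context: Dirichlet characters are extended by $0$ to integers not coprime to their modulus. $B_1(x)=0$ if $x\in\mathbb{Z}$ and $B_1(x)=x-\lfloor x\rfloor-\tfrac12$ otherwise. For integers $a$ and $c\ge1$ with $q_1q_2\mid c$, \[S_{\chi_1,\chi_2}(a,c)=\sum_{j\bmod c}\sum_{n\bmod q_1}\overline{\chi_2}(j)\overline{\chi_1}(n)B_1\!\Big(\frac{j}{c}\Big)B_1\!\Big(\frac{n}{q_1}+\frac{aj}{c}\Big).\] *)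

theory Defs
  imports "HOL-Analysis.Analysis"
begin

text \<open>
  Dirichlet characters are total functions on the integers, extended by \<open>0\<close> off the residues coprime
  to the modulus. The normalisation \<open>\<psi> 1 = 1\<close> follows from multiplicativity and \<open>\<psi> 1 \<noteq> 0\<close>.
\<close>

definition dirichlet_character :: "nat \<Rightarrow> (int \<Rightarrow> complex) \<Rightarrow> bool" where
  "dirichlet_character q \<psi> \<longleftrightarrow>
     q > 0 \<and>
     (\<forall>m n. \<psi> (m * n) = \<psi> m * \<psi> n) \<and>
     (\<forall>n. \<psi> (n + int q) = \<psi> n) \<and>
     (\<forall>n. \<psi> n \<noteq> 0 \<longleftrightarrow> coprime n (int q))"

definition nontrivial_character :: "nat \<Rightarrow> (int \<Rightarrow> complex) \<Rightarrow> bool" where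
  "nontrivial_character q \<psi> \<longleftrightarrow> (\<exists>n. coprime n (int q) \<and> \<psi> n \<noteq> 1)"

text \<open>Primitive: not induced by any character whose modulus is a proper divisor of \<open>q\<close>.\<close>

definition primitive_character :: "nat \<Rightarrow> (int \<Rightarrow> complex) \<Rightarrow> bool" where
  "primitive_character q \<psi> \<longleftrightarrow>
     dirichlet_character q \<psi> \<and>
     \<not> (\<exists>d \<phi>. d dvd q \<and> d < q \<and> dirichlet_character d \<phi> \<and>
             (\<forall>n. coprime n (int q) \<longrightarrow> \<psi> n = \<phi> n))"

definition B1 :: "real \<Rightarrow> real" where
  "B1 x = (if x \<in> \<int> then 0 else x - of_int \<lfloor>x\<rfloor> - 1 / 2)"

text \<open>
  The modulus \<open>q1\<close> of \<open>\<chi>1\<close> is an explicit argument; that of \<open>\<chi>2\<close> does not occur in the sum.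
\<close>

definition dedekind_sum ::
    "nat \<Rightarrow> (int \<Rightarrow> complex) \<Rightarrow> (int \<Rightarrow> complex) \<Rightarrow> int \<Rightarrow> nat \<Rightarrow> complex" where
  "dedekind_sum q1 \<chi>1 \<chi>2 a c =
     (\<Sum>j\<in>{0..<int c}. \<Sum>n\<in>{0..<int q1}.
        cnj (\<chi>2 j) * cnj (\<chi>1 n) *
        of_real (B1 (of_int j / of_nat c)) *
        of_real (B1 (of_int n / of_nat q1 + of_int (a * j) / of_nat c)))"

end

theory Submission
  imports Defs "HOL-Number_Theory.Cong" "HOL-Computational_Algebra.Primes"
begin

text \<open>
  Write \<open>c = q2 * d\<close>. Expanding \<open>B1 (j / c)\<close> in additive characters mod \<open>c\<close> turns \<open>S(a,c)\<close> into a sum over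
  \<open>k\<close> mod \<open>c\<close> of products of Fourier coefficients of the sawtooth at \<open>k\<close> and at the points congruent to
  \<open>a k\<close> mod \<open>d\<close>, weighted by Gauss sums of the two characters. Primitivity bounds the Gauss sums by
  \<open>sqrt q1\<close> and \<open>sqrt q2\<close>, and nontriviality of the first character removes the terms with \<open>d\<close> dividing
  \<open>k\<close>. The Fourier coefficients decay like the reciprocal distance to the multiples of \<open>c\<close>, so summing
  over the residues mod \<open>c\<close> in a class mod \<open>d\<close> gives
  \<open>|S(a,c)| \<le> sqrt (q1 / q2) * c * (log c)^2 * T(a)\<close> up to a constant, where \<open>T(a)\<close> is the sum over \<open>k\<close> mod \<open>d\<close>
  of \<open>1 / (\<parallel>k\<parallel> * \<parallel>a k\<parallel>)\<close> with \<open>\<parallel>_\<parallel>\<close> the distance to the multiples of \<open>d\<close>. Trivially \<open>T(a)\<close> is at most of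
  order \<open>log c\<close>, and summing over \<open>a\<close> first shows that \<open>T\<close> is at most of order \<open>(log c)^2\<close> on average. Hence
  the second moment is at most of order \<open>q1 * c^2 * (log c)^7\<close>.
\<close>

section \<open>Sums over residue systems and additive characters\<close>

text \<open>The hypothesis on \<open>h\<close> is injectivity modulo \<open>m\<close>, so reducing
  its values permutes the finite set of representatives.\<close>

lemma sum_residues_reindex:
  fixes f :: "int \<Rightarrow> 'a::comm_monoid_add"
  assumes per: "\<And>x. f (x mod m) = f x" and m: "m > 0"
    and inj: "\<And>x y. x \<in> {0..<m} \<Longrightarrow> y \<in> {0..<m} \<Longrightarrow> m dvd h x - h y \<Longrightarrow> m dvd x - y"
  shows "(\<Sum>x\<in>{0..<m}. f (h x)) = (\<Sum>x\<in>{0..<m}. f x)"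
proof -
  have "inj_on (\<lambda>x. h x mod m) {0..<m}"
  proof (rule inj_onI)
    fix x y assume xy: "x \<in> {0..<m}" "y \<in> {0..<m}" "h x mod m = h y mod m"
    then have "m dvd x - y" using inj by (simp add: mod_eq_dvd_iff)
    then show "x = y" using xy by (simp add: mod_eq_dvd_iff [symmetric])
  qed
  moreover have "(\<lambda>x. h x mod m) ` {0..<m} \<subseteq> {0..<m}" using m by auto
  ultimately have "bij_betw (\<lambda>x. h x mod m) {0..<m} {0..<m}"
    by (simp add: bij_betw_def endo_inj_surj)
  from sum.reindex_bij_betw [OF this, of f] show ?thesis by (simp add: per)
qed

lemma sum_residues_mult:
  fixes f :: "int \<Rightarrow> 'a::comm_monoid_add"
  assumes "\<And>x. f (x mod m) = f x" "m > 0" "coprime u m"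
  shows "(\<Sum>x\<in>{0..<m}. f (u * x)) = (\<Sum>x\<in>{0..<m}. f x)"
proof (rule sum_residues_reindex [where f = f, OF assms(1,2)])
  fix x y assume "m dvd u * x - u * y"
  then have "m dvd u * (x - y)" by (simp add: algebra_simps)
  then show "m dvd x - y" using assms(3) by (simp add: coprime_dvd_mult_right_iff coprime_commute)
qed

lemma sum_residues_shift:
  fixes f :: "int \<Rightarrow> 'a::comm_monoid_add"
  assumes "\<And>x. f (x mod m) = f x" "m > 0"
  shows "(\<Sum>x\<in>{0..<m}. f (x + t)) = (\<Sum>x\<in>{0..<m}. f x)"
  by (rule sum_residues_reindex [where f = f, OF assms]) simp

text \<open>Division with remainder by \<open>d\<close>. It serves to group frequencies modulo
  \<open>c = q2 * d\<close> by their class modulo \<open>d\<close>.\<close>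

lemma sum_residues_split:
  fixes f :: "int \<Rightarrow> 'a::comm_monoid_add"
  assumes d: "d > 0" and q: "q > 0"
  shows "(\<Sum>x\<in>{0..<q * d}. f x) = (\<Sum>r\<in>{0..<d}. \<Sum>l\<in>{0..<q}. f (r + l * d))"
proof -
  have "(\<Sum>r\<in>{0..<d}. \<Sum>l\<in>{0..<q}. f (r + l * d)) = (\<Sum>(r, l)\<in>{0..<d} \<times> {0..<q}. f (r + l * d))"
    by (simp add: sum.cartesian_product)
  also have "\<dots> = (\<Sum>x\<in>{0..<q * d}. f x)"
  proof (rule sum.reindex_bij_witness [where i = "\<lambda>x. (x mod d, x div d)" and j = "\<lambda>(r, l). r + l * d"])
    fix x assume "x \<in> {0..<q * d}"
    then have x: "0 \<le> x" "x < q * d" by auto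
    have "x div d * d \<le> x" using d by (simp add: minus_mod_eq_div_mult [symmetric])
    then have "x div d * d < q * d" using x by simp
    then have "x div d < q" using d by simp
    moreover have "0 \<le> x div d" using x d by (simp add: pos_imp_zdiv_nonneg_iff)
    ultimately show "(x mod d, x div d) \<in> {0..<d} \<times> {0..<q}" using d by simp
  next
    fix p assume "p \<in> {0..<d} \<times> {0..<q}"
    then obtain r l where p: "p = (r, l)" "0 \<le> r" "r < d" "0 \<le> l" "l < q" by auto
    then have "(l + 1) * d \<le> q * d" using d by (intro mult_right_mono) auto
    then show "(case p of (r, l) \<Rightarrow> r + l * d) \<in> {0..<q * d}"
      using p d by (auto simp: algebra_simps)
  qed (use d in auto)
  finally show ?thesis by simp
qed

section \<open>Additive characters modulo \<open>m\<close> and their orthogonality\<close>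

definition ee :: "int \<Rightarrow> int \<Rightarrow> complex" where
  "ee m x = cis (2 * pi * (of_int x / of_int m))"

lemma ee_add: "ee m (x + y) = ee m x * ee m y"
  by (simp add: ee_def cis_mult ring_distribs add_divide_distrib)

lemma ee_0 [simp]: "ee m 0 = 1"
  by (simp add: ee_def)

lemma norm_ee [simp]: "cmod (ee m x) = 1"
  by (simp add: ee_def)

lemma cnj_ee: "cnj (ee m x) = ee m (- x)"
  by (simp add: ee_def cis_cnj)

lemma ee_cancel: "g \<noteq> 0 \<Longrightarrow> ee (g * m) (g * x) = ee m x"
  by (simp add: ee_def del: times_divide_eq_right)

lemma ee_multiple [simp]: "m \<noteq> 0 \<Longrightarrow> ee m (m * x) = 1"
  using cis_multiple_2pi [of "of_int x"] by (simp add: ee_def)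

lemma ee_cong: "m \<noteq> 0 \<Longrightarrow> m dvd x - y \<Longrightarrow> ee m x = ee m y"
  using ee_add [of m y "x - y"] by auto

lemma ee_mod: "m \<noteq> 0 \<Longrightarrow> ee m (x mod m) = ee m x"
  by (rule ee_cong) (simp_all add: mod_eq_dvd_iff [symmetric])

text \<open>A chord of the unit circle subtending the angle \<open>t\<close> has length twice the
  absolute value of \<open>sin (t / 2)\<close>.\<close>

lemma norm_one_minus_ee: "cmod (1 - ee m x) = 2 * \<bar>sin (pi * of_int x / of_int m)\<bar>"
  using dist_exp_i_1 [of "2 * pi * (of_int x / of_int m)"]
  by (simp add: ee_def cis_conv_exp norm_minus_commute dist_norm)

lemma ee_eq_1_iff: "m > 0 \<Longrightarrow> ee m x = 1 \<longleftrightarrow> m dvd x"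
proof
  assume m: "m > 0" and "ee m x = 1"
  then have "sin (pi * of_int x / of_int m) = 0"
    using norm_one_minus_ee [of m x] by simp
  then obtain i :: int where "pi * of_int x / of_int m = of_int i * pi"
    by (auto simp: sin_zero_iff_int2)
  then have "real_of_int x = of_int (i * m)" using m by (simp add: field_simps)
  then show "m dvd x" by (metis dvd_triv_right of_int_eq_iff)
qed auto

text \<open>Shifting the summation variable by one multiplies the sum by \<open>ee m y\<close>, so
  it vanishes unless that factor is \<open>1\<close>.\<close>

lemma sum_ee:
  assumes "m > 0"
  shows "(\<Sum>x\<in>{0..<m}. ee m (x * y)) = (if m dvd y then of_int m else 0)"
proof (cases "m dvd y")
  case True
  then have "ee m (x * y) = 1" for x
    using assms by (subst ee_eq_1_iff) auto
  then show ?thesis using True assms by simp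
next
  case False
  let ?s = "\<Sum>x\<in>{0..<m}. ee m (x * y)"
  have "?s = (\<Sum>x\<in>{0..<m}. ee m ((x + 1) * y))"
  proof (rule sum_residues_shift [of "\<lambda>x. ee m (x * y)", symmetric])
    fix x show "ee m (x mod m * y) = ee m (x * y)"
      using assms by (metis ee_mod less_irrefl mod_mult_left_eq)
  qed (fact assms)
  also have "\<dots> = ee m y * ?s"
    by (simp add: sum_distrib_left ee_add distrib_right mult.commute [of "ee m y"])
  finally have "(1 - ee m y) * ?s = 0" by (simp add: algebra_simps)
  then show ?thesis using False assms by (auto simp: ee_eq_1_iff)
qed

section \<open>Gauss sums of primitive characters\<close>

text \<open>Unnormalised and with positive exponent. For a conjugated character and its own modulus
  the values are Gauss sums.\<close>

definition dft :: "int \<Rightarrow> (int \<Rightarrow> complex) \<Rightarrow> int \<Rightarrow> complex" where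
  "dft m f k = (\<Sum>n\<in>{0..<m}. f n * ee m (n * k))"

lemma dft_mod: "m \<noteq> 0 \<Longrightarrow> dft m f (k mod m) = dft m f k"
  unfolding dft_def by (intro sum.cong refl arg_cong2 [where f = "(*)"]) (metis ee_mod mod_mult_right_eq)

lemma dft_inverse:
  assumes per: "\<And>x. f (x mod m) = f x" and m: "m > 0"
  shows "f j = (\<Sum>l\<in>{0..<m}. dft m f l * ee m (- (l * j))) / of_int m"
proof -
  have e: "ee m (n * l) * ee m (- (l * j)) = ee m (l * (n - j))" for n l
    by (simp add: ee_add [symmetric] algebra_simps)
  have "(\<Sum>l\<in>{0..<m}. dft m f l * ee m (- (l * j)))
      = (\<Sum>l\<in>{0..<m}. \<Sum>n\<in>{0..<m}. f n * ee m (l * (n - j)))"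
    by (simp add: dft_def sum_distrib_right mult.assoc e)
  also have "\<dots> = (\<Sum>n\<in>{0..<m}. f n * (\<Sum>l\<in>{0..<m}. ee m (l * (n - j))))"
    by (subst sum.swap) (simp add: sum_distrib_left)
  also have "\<dots> = (\<Sum>n\<in>{0..<m}. if n = j mod m then of_int m * f n else 0)"
  proof (rule sum.cong [OF refl])
    fix n assume "n \<in> {0..<m}"
    then have "m dvd n - j \<longleftrightarrow> n = j mod m" by (auto simp: mod_eq_dvd_iff [symmetric])
    then show "f n * (\<Sum>l\<in>{0..<m}. ee m (l * (n - j))) = (if n = j mod m then of_int m * f n else 0)"
      using m by (simp add: sum_ee)
  qed
  also have "\<dots> = of_int m * f j"
    using m by (simp add: per)
  finally show ?thesis using m by simp
qed

text \<open>Parseval's identity: after expanding the squares, orthogonality in \<open>k\<close>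
  leaves only the diagonal \<open>n = n'\<close>.\<close>

lemma dft_parseval:
  assumes m: "m > 0"
  shows "(\<Sum>k\<in>{0..<m}. (cmod (dft m f k))\<^sup>2) = of_int m * (\<Sum>n\<in>{0..<m}. (cmod (f n))\<^sup>2)"
proof -
  have e: "f n * ee m (n * k) * (cnj (f n') * ee m (- (n' * k))) = f n * cnj (f n') * ee m (k * (n - n'))" for n n' k
    using ee_add [of m "n * k" "- (n' * k)"] by (simp add: algebra_simps)
  have "(\<Sum>k\<in>{0..<m}. complex_of_real ((cmod (dft m f k))\<^sup>2))
      = (\<Sum>k\<in>{0..<m}. \<Sum>n\<in>{0..<m}. \<Sum>n'\<in>{0..<m}. f n * cnj (f n') * ee m (k * (n - n')))"
    unfolding complex_norm_square dft_def
    by (simp add: sum_product cnj_ee e)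
  also have "\<dots> = (\<Sum>n\<in>{0..<m}. \<Sum>n'\<in>{0..<m}. f n * cnj (f n') * (\<Sum>k\<in>{0..<m}. ee m (k * (n - n'))))"
    by (subst sum.swap, rule sum.cong [OF refl], subst sum.swap) (simp add: sum_distrib_left)
  also have "\<dots> = (\<Sum>n\<in>{0..<m}. \<Sum>n'\<in>{0..<m}. if n' = n then of_int m * (f n * cnj (f n)) else 0)"
  proof (intro sum.cong refl)
    fix n n' assume "n \<in> {0..<m}" "n' \<in> {0..<m}"
    then have "m dvd n - n' \<longleftrightarrow> n' = n" by (auto simp: mod_eq_dvd_iff [symmetric])
    then show "f n * cnj (f n') * (\<Sum>k\<in>{0..<m}. ee m (k * (n - n')))
        = (if n' = n then of_int m * (f n * cnj (f n)) else 0)"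
      using m by (simp add: sum_ee)
  qed
  also have "\<dots> = of_int m * (\<Sum>n\<in>{0..<m}. complex_of_real ((cmod (f n))\<^sup>2))"
    by (simp only: complex_norm_square sum_distrib_left) simp
  finally have "complex_of_real (\<Sum>k\<in>{0..<m}. (cmod (dft m f k))\<^sup>2)
      = complex_of_real (of_int m * (\<Sum>n\<in>{0..<m}. (cmod (f n))\<^sup>2))"
    by simp
  then show ?thesis by (simp only: of_real_eq_iff)
qed

section \<open>Dirichlet characters and their Gauss sums\<close>

lemma periodic_mod:
  fixes f :: "int \<Rightarrow> 'a"
  assumes "\<And>n. f (n + m) = f n"
  shows "f (x mod m) = f x"
proof -
  have add: "f (x + int k * m) = f x" for x k
  proof (induction k)
    case (Suc k)
    then show ?case using assms [of "x + int k * m"] by (simp add: algebra_simps)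
  qed simp
  have *: "f (x + k * m) = f x" for x k
  proof (cases "k \<ge> 0")
    case True
    then show ?thesis using add [of x "nat k"] by simp
  next
    case False
    then show ?thesis using add [of "x + k * m" "nat (- k)"] by simp
  qed
  show ?thesis using * [of "x mod m" "x div m"] by simp
qed

context
  fixes q :: nat and \<psi> :: "int \<Rightarrow> complex"
  assumes chi: "dirichlet_character q \<psi>"
begin

lemma modulus_pos: "int q > 0"
  using chi by (simp add: dirichlet_character_def)

lemma char_mult: "\<psi> (m * n) = \<psi> m * \<psi> n"
  using chi by (simp add: dirichlet_character_def)

lemma char_eq_0_iff: "\<psi> n = 0 \<longleftrightarrow> \<not> coprime n (int q)"
  using chi by (auto simp: dirichlet_character_def)

lemma char_mod: "\<psi> (n mod int q) = \<psi> n"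
  by (rule periodic_mod) (use chi in \<open>simp add: dirichlet_character_def\<close>)

lemma char_1: "\<psi> 1 = 1"
  using char_mult [of 1 1] char_eq_0_iff [of 1] by simp

text \<open>The powers of \<open>\<psi> n\<close> are values of \<open>\<psi>\<close>, of which there are finitely many.\<close>

lemma norm_char_le_1: "cmod (\<psi> n) \<le> 1"
proof (rule ccontr)
  assume "\<not> ?thesis"
  then have n: "cmod (\<psi> n) > 1" by simp
  \<comment> \<open>The sum of the norms over one period bounds every value, and the powers of
    \<open>\<psi> n\<close> would exceed it.\<close>
  define B where "B = (\<Sum>r\<in>{0..<int q}. cmod (\<psi> r))"
  have le_B: "cmod (\<psi> x) \<le> B" for x
  proof -
    have "cmod (\<psi> (x mod int q)) \<le> B"
      unfolding B_def using modulus_pos by (intro member_le_sum) auto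
    then show ?thesis by (simp add: char_mod)
  qed
  have pow: "\<psi> (n ^ k) = \<psi> n ^ k" for k
    by (induction k) (simp_all add: char_mult char_1)
  obtain k where "B < cmod (\<psi> n) ^ k" using real_arch_pow [OF n] by blast
  then show False using le_B [of "n ^ k"] by (simp add: pow norm_power)
qed

text \<open>Substituting \<open>u * n\<close> for \<open>n\<close> permutes the residues and pulls
  out \<open>cnj (\<psi> u)\<close>.\<close>

lemma dft_char_mult:
  assumes "coprime u (int q)"
  shows "dft (int q) (\<lambda>n. cnj (\<psi> n)) k = cnj (\<psi> u) * dft (int q) (\<lambda>n. cnj (\<psi> n)) (u * k)"
proof -
  have "dft (int q) (\<lambda>n. cnj (\<psi> n)) k = (\<Sum>n\<in>{0..<int q}. cnj (\<psi> (u * n)) * ee (int q) (u * n * k))"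
    unfolding dft_def
  proof (rule sum_residues_mult [symmetric])
    show "cnj (\<psi> (x mod int q)) * ee (int q) (x mod int q * k) = cnj (\<psi> x) * ee (int q) (x * k)" for x
      using modulus_pos by (metis char_mod ee_mod less_irrefl mod_mult_left_eq)
  qed (use modulus_pos assms in auto)
  then show ?thesis
    by (simp add: dft_def char_mult sum_distrib_left mult_ac)
qed

text \<open>Multiplying \<open>k\<close> by a unit \<open>u\<close> does not change its class
  \<open>0\<close>, so the value equals \<open>cnj (\<psi> u)\<close> times itself; nontriviality
  supplies a \<open>u\<close> where this factor is not \<open>1\<close>.\<close>

lemma dft_nontrivial_char_0:
  assumes "nontrivial_character q \<psi>" "int q dvd k"
  shows "dft (int q) (\<lambda>n. cnj (\<psi> n)) k = 0"
proof -
  obtain u where u: "coprime u (int q)" "\<psi> u \<noteq> 1"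
    using assms(1) by (auto simp: nontrivial_character_def)
  have "dft (int q) (\<lambda>n. cnj (\<psi> n)) (u * k) = dft (int q) (\<lambda>n. cnj (\<psi> n)) k"
    using assms(2) modulus_pos by (metis dft_mod dvd_mult mod_0_imp_dvd dvd_imp_mod_0 less_irrefl)
  then have "dft (int q) (\<lambda>n. cnj (\<psi> n)) k = cnj (\<psi> u) * dft (int q) (\<lambda>n. cnj (\<psi> n)) k"
    using dft_char_mult [OF u(1), of k] by simp
  then show ?thesis using u(2) by auto
qed

end

text \<open>When \<open>d\<close> divides \<open>q\<close>, this says that units modulo
  \<open>d\<close> lift to units modulo \<open>q\<close>; it is used to extend a character from
  modulus \<open>q\<close> down to modulus \<open>d\<close>.\<close>

lemma exists_coprime_in_residue_class:
  fixes n d q :: int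
  assumes "coprime n d" "q > 0"
  shows "\<exists>n'. d dvd n' - n \<and> coprime n' q"
proof -
  \<comment> \<open>With \<open>t\<close> the product of these primes, each prime dividing
    \<open>q\<close> divides exactly one of \<open>n\<close> and \<open>d * t\<close>, hence not
    their sum.\<close>
  define P where "P = {p. prime p \<and> p dvd q \<and> \<not> p dvd n}"
  define t where "t = \<Prod>P"
  have P: "finite P"
    unfolding P_def using assms(2) by (intro finite_subset [OF _ finite_divisors_int [of q]]) auto
  have "coprime (n + d * t) q"
  proof (rule ccontr)
    assume "\<not> ?thesis"
    then have "gcd (n + d * t) q \<noteq> 0" "\<not> is_unit (gcd (n + d * t) q)"
      using assms(2) by (auto simp: coprime_iff_gcd_eq_1)
    then obtain p where p: "prime p" "p dvd n + d * t" "p dvd q"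
      using prime_divisor_exists [of "gcd (n + d * t) q"] by auto
    show False
    proof (cases "p dvd n")
      case True
      then have "p dvd d * t" using p(2) by (simp add: dvd_add_right_iff)
      moreover have "\<not> p dvd d"
        using assms(1) True p(1) by (meson coprime_common_divisor not_prime_unit)
      ultimately have "p dvd t" using p(1) by (simp add: prime_dvd_mult_iff)
      then obtain r where "r \<in> P" "p dvd r"
        using P p(1) by (auto simp: t_def prime_dvd_prod_iff)
      then show ?thesis
        using True p(1) by (auto simp: P_def dest: primes_dvd_imp_eq)
    next
      case False
      then have "p \<in> P" using p by (simp add: P_def)
      then have "p dvd t" unfolding t_def using P by (auto intro: dvd_prod_eqI)
      then show ?thesis using p(2) False by (simp add: dvd_add_left_iff)
    qed
  qed
  then show ?thesis by (intro exI [of _ "n + d * t"]) simp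
qed

text \<open>
  A character mod \<open>q\<close> that is trivial on the units congruent to \<open>1\<close> mod \<open>d\<close> is induced from modulus \<open>d\<close>.
\<close>

lemma primitive_character_separates:
  assumes prim: "primitive_character q \<psi>" and d: "d dvd q" "d < q"
  shows "\<exists>u. coprime u (int q) \<and> int d dvd u - 1 \<and> \<psi> u \<noteq> 1"
proof (rule ccontr)
  assume "\<not> ?thesis"
  then have triv: "\<And>u. coprime u (int q) \<Longrightarrow> int d dvd u - 1 \<Longrightarrow> \<psi> u = 1" by blast
  have chi: "dirichlet_character q \<psi>" using prim by (simp add: primitive_character_def)
  note q = modulus_pos [OF chi]
  have dq: "int d dvd int q" using d by simp
  have "d > 0" using d q by (auto intro: Nat.gr0I)
  \<comment> \<open>On units, \<open>\<psi>\<close> depends only on the class modulo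
    \<open>d\<close>: for \<open>v\<close> inverse to \<open>n\<close> modulo \<open>q\<close>, both
    \<open>m * v\<close> and \<open>n * v\<close> are \<open>1\<close> modulo
    \<open>d\<close>.\<close>
  have eq: "\<psi> m = \<psi> n"
    if coprime_m: "coprime m (int q)" and coprime_n: "coprime n (int q)" and mn: "int d dvd m - n" for m n
  proof -
    obtain v where v: "int q dvd n * v - 1"
      using coprime_n cong_solve_coprime_int [of n "int q"] by (auto simp: cong_iff_dvd_diff)
    then have cv: "coprime v (int q)"
      by (metis coprime_iff_invertible_int cong_iff_dvd_diff mult.commute)
    have "m * v - 1 = (m - n) * v + (n * v - 1)" by (simp add: algebra_simps)
    then have "int d dvd m * v - 1" using mn v dq by (metis dvd_add dvd_mult2 dvd_trans)
    then have "\<psi> (m * v) = 1" using triv coprime_m coprime_n cv by simp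
    moreover have "\<psi> (n * v) = 1" using triv coprime_m coprime_n cv v dq by (meson coprime_mult_left_iff dvd_trans)
    ultimately have "\<psi> m * \<psi> v = \<psi> n * \<psi> v" by (simp add: char_mult [OF chi])
    then show ?thesis using cv char_eq_0_iff [OF chi, of v] by simp
  qed
  \<comment> \<open>An arbitrary unit modulo \<open>q\<close> in the class of \<open>n\<close>
    modulo \<open>d\<close>; by \<open>eq\<close> the choice does not affect
    \<open>\<psi> (lift n)\<close>.\<close>
  define lift where "lift n = (SOME n'. int d dvd n' - n \<and> coprime n' (int q))" for n
  define \<phi> where "\<phi> n = (if coprime n (int d) then \<psi> (lift n) else 0)" for n
  have lift: "int d dvd lift n - n" "coprime (lift n) (int q)" if "coprime n (int d)" for n
    using someI_ex [OF exists_coprime_in_residue_class [OF that q]] by (auto simp: lift_def)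
  have phi: "\<phi> n = \<psi> n'" if "coprime n' (int q)" "int d dvd n' - n" "coprime n (int d)" for n n'
  proof -
    have "int d dvd lift n - n'" using dvd_diff [OF lift(1) [OF that(3)] that(2)] by simp
    then show ?thesis using eq [OF lift(2) [OF that(3)] that(1)] that(3) by (simp add: \<phi>_def)
  qed
  have "dirichlet_character d \<phi>"
    unfolding dirichlet_character_def
  proof (intro conjI allI)
    show "0 < d" by fact
    fix m n
    show "\<phi> (m * n) = \<phi> m * \<phi> n"
    proof (cases "coprime m (int d) \<and> coprime n (int d)")
      case True
      have "lift m * lift n - m * n = (lift m - m) * lift n + m * (lift n - n)"
        by (simp add: algebra_simps)
      then have "int d dvd lift m * lift n - m * n" using True by (simp add: lift)
      then have "\<phi> (m * n) = \<psi> (lift m * lift n)" using True by (intro phi) (auto simp: lift)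
      then show ?thesis using True by (simp add: char_mult [OF chi] \<phi>_def)
    qed (auto simp: \<phi>_def)
    have shift: "coprime (n + int d) (int d) \<longleftrightarrow> coprime n (int d)"
      unfolding coprime_iff_gcd_eq_1 by simp
    show "\<phi> (n + int d) = \<phi> n"
    proof (cases "coprime n (int d)")
      case True
      then have "coprime (n + int d) (int d)" by (simp add: shift)
      moreover have "int d dvd lift n - (n + int d)"
        using dvd_diff [OF lift(1) [OF True] dvd_refl] by (simp add: diff_diff_eq)
      ultimately show ?thesis using True lift(2) [OF True] phi [of "lift n"] lift(1) by auto
    qed (simp add: \<phi>_def shift)
    show "\<phi> n \<noteq> 0 \<longleftrightarrow> coprime n (int d)"
      using lift(2) [of n] char_eq_0_iff [OF chi] by (auto simp: \<phi>_def)
  qed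
  moreover have "\<psi> n = \<phi> n" if "coprime n (int q)" for n
    using phi [OF that, of n] coprime_divisors [OF dvd_refl dq that] by simp
  ultimately show False using prim d by (auto simp: primitive_character_def)
qed

text \<open>If \<open>k\<close> shares a factor \<open>g > 1\<close> with \<open>q\<close>, a unit
  that is \<open>1\<close> modulo \<open>q / g\<close> fixes \<open>k\<close> modulo
  \<open>q\<close>, and primitivity makes the sum vanish. For coprime \<open>k\<close>, Parseval is
  applied to the unit multiples of \<open>k\<close>.\<close>

lemma norm_dft_primitive_char:
  assumes prim: "primitive_character q \<psi>"
  shows "cmod (dft (int q) (\<lambda>n. cnj (\<psi> n)) k) \<le> sqrt (real q)"
proof -
  have chi: "dirichlet_character q \<psi>" using prim by (simp add: primitive_character_def)
  note q = modulus_pos [OF chi]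
  let ?G = "dft (int q) (\<lambda>n. cnj (\<psi> n))"
  show ?thesis
  proof (cases "coprime k (int q)")
    case False
    define g where "g = gcd k (int q)"
    have g: "g > 1"
      using False q by (metis coprime_iff_gcd_eq_1 g_def gcd_pos_int less_irrefl zless_imp_add1_zle add_0 order_le_less)
    obtain k' where k': "k = g * k'" unfolding g_def by (metis dvdE gcd_dvd1)
    obtain d' where d': "int q = g * d'" unfolding g_def by (metis dvdE gcd_dvd2)
    then have "d' > 0" using q g by (metis zero_less_mult_pos order.strict_trans zero_less_one)
    define d where "d = nat d'"
    have d: "int d = d'" using \<open>d' > 0\<close> by (simp add: d_def)
    have "int d dvd int q" "int d < int q" using d d' g \<open>d' > 0\<close> by auto
    then have "d dvd q" "d < q" by auto
    then obtain u where u: "coprime u (int q)" "int d dvd u - 1" "\<psi> u \<noteq> 1"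
      using primitive_character_separates [OF prim] by blast
    have "int q dvd u * k - k"
    proof -
      obtain w where "u - 1 = d' * w" using u(2) d by auto
      then have "u * k - k = int q * (w * k')" unfolding k' d' by (simp add: algebra_simps)
      then show ?thesis by simp
    qed
    then have "?G (u * k) = ?G k" using q by (metis dft_mod less_irrefl mod_eq_dvd_iff)
    then have "?G k = cnj (\<psi> u) * ?G k" using dft_char_mult [OF chi u(1), of k] by simp
    then have "?G k = 0" using u(3) by auto
    then show ?thesis by simp
  next
    case True
    define U where "U = {u\<in>{0..<int q}. coprime u (int q)}"
    \<comment> \<open>Reduced modulo \<open>q\<close> because for \<open>q = 1\<close> the only
      representative is \<open>0\<close>.\<close>
    have "1 mod int q \<in> U" using q by (simp add: U_def)
    moreover have "finite U" by (rule finite_subset [of _ "{0..<int q}"]) (auto simp: U_def)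
    ultimately have U: "card U > 0" by (auto simp: card_gt_0_iff)
    \<comment> \<open>The factor \<open>card U\<close> appears on both sides, first as the number of
      unit multiples of \<open>k\<close>, then as the size of the support of \<open>\<psi>\<close>,
      and cancels.\<close>
    have "real (card U) * (cmod (?G k))\<^sup>2 = (\<Sum>u\<in>U. (cmod (?G k))\<^sup>2)" by simp
    also have "\<dots> \<le> (\<Sum>u\<in>U. (cmod (?G (u * k)))\<^sup>2)"
    proof (intro sum_mono power_mono)
      fix u assume "u \<in> U"
      then have "cmod (?G k) = cmod (\<psi> u) * cmod (?G (u * k))"
        using dft_char_mult [OF chi, of u k] by (simp add: U_def norm_mult)
      also have "\<dots> \<le> 1 * cmod (?G (u * k))"
        by (intro mult_right_mono norm_char_le_1 [OF chi]) simp
      finally show "cmod (?G k) \<le> cmod (?G (u * k))" by simp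
    qed simp
    also have "\<dots> \<le> (\<Sum>u\<in>{0..<int q}. (cmod (?G (k * u)))\<^sup>2)"
      unfolding mult.commute [of _ k] by (intro sum_mono2) (auto simp: U_def)
    also have "\<dots> = (\<Sum>u\<in>{0..<int q}. (cmod (?G u))\<^sup>2)"
      using q True by (intro sum_residues_mult) (simp_all add: dft_mod)
    also have "\<dots> = real q * (\<Sum>n\<in>{0..<int q}. (cmod (\<psi> n))\<^sup>2)"
      using q by (subst dft_parseval) simp_all
    also have "(\<Sum>n\<in>{0..<int q}. (cmod (\<psi> n))\<^sup>2) = (\<Sum>n\<in>U. (cmod (\<psi> n))\<^sup>2)"
      by (rule sum.mono_neutral_right) (auto simp: U_def char_eq_0_iff [OF chi])
    also have "\<dots> \<le> (\<Sum>n\<in>U. 1)"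
      by (intro sum_mono) (simp add: norm_char_le_1 [OF chi] power_le_one)
    finally have "real (card U) * (cmod (?G k))\<^sup>2 \<le> real (card U) * real q"
      by (simp add: mult_right_mono mult.commute)
    then have "(cmod (?G k))\<^sup>2 \<le> real q" using U by simp
    then show ?thesis by (rule real_le_rsqrt)
  qed
qed

section \<open>Reciprocal distance to the multiples of a modulus\<close>

text \<open>
  Comparable to the reciprocal of the distance from \<open>x\<close> to the nearest multiple of \<open>m\<close>; as a sum of two
  terms it adds up conveniently along progressions. Multiples of \<open>m\<close> get the value \<open>0\<close>.
\<close>

definition wt :: "int \<Rightarrow> int \<Rightarrow> real" where
  "wt m x = (if m dvd x then 0 else 1 / of_int (x mod m) + 1 / of_int (m - x mod m))"

lemma wt_mod: "wt m (x mod m) = wt m x"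
  by (simp add: wt_def dvd_mod_iff)

lemma wt_cong: "x mod m = y mod m \<Longrightarrow> wt m x = wt m y"
  by (metis wt_mod)

lemma wt_uminus: "wt m (- x) = wt m x"
  by (simp add: wt_def zmod_zminus1_eq_if mod_eq_0_iff_dvd)

lemma mod_pos_of_not_dvd:
  fixes m x :: int
  assumes "m > 0" "\<not> m dvd x"
  shows "0 < x mod m"
  using assms by (metis dvd_eq_mod_eq_0 order_le_less pos_mod_sign)

lemma wt_nonneg:
  assumes "m > 0"
  shows "0 \<le> wt m x"
proof (cases "m dvd x")
  case False
  then have "0 < real_of_int (x mod m)" "0 < real_of_int (m - x mod m)"
    using mod_pos_of_not_dvd [of m x] pos_mod_bound [of m x] assms by simp_all
  then show ?thesis using False by (simp add: wt_def del: of_int_diff)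
qed (simp add: wt_def)

lemma wt_le_2:
  assumes "m > 0"
  shows "wt m x \<le> 2"
proof (cases "m dvd x")
  case False
  then have "real_of_int (x mod m) \<ge> 1" "real_of_int (m - x mod m) \<ge> 1"
    using mod_pos_of_not_dvd [of m x] pos_mod_bound [of m x] assms by linarith+
  then have "1 / real_of_int (x mod m) \<le> 1" "1 / real_of_int (m - x mod m) \<le> 1" by simp_all
  then show ?thesis using False by (simp add: wt_def)
qed (simp add: wt_def)

lemma wt_scale:
  assumes "g > 0" "m > 0"
  shows "g * wt (g * m) (g * x) = wt m x"
proof (cases "m dvd x")
  case False
  have e: "g * m - g * (x mod m) = g * (m - x mod m)" by (simp add: right_diff_distrib)
  have "wt (g * m) (g * x) = 1 / real_of_int (g * (x mod m)) + 1 / real_of_int (g * (m - x mod m))"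
    using False assms by (simp add: wt_def e del: of_int_diff of_int_mult)
  then show ?thesis using False assms by (simp add: wt_def distrib_left del: of_int_diff)
qed (use assms in \<open>simp add: wt_def\<close>)

text \<open>The harmonic sum bound, by induction from \<open>ln x \<le> x - 1\<close> at
  \<open>x = n / (n + 1)\<close>.\<close>

lemma sum_inverse_le:
  assumes "n \<ge> 1"
  shows "(\<Sum>l\<in>{1..<int n}. 1 / real_of_int l) \<le> 1 + ln (real n)"
proof -
  have "(\<Sum>l\<in>{1..<int n}. 1 / real_of_int l) = (\<Sum>k\<in>{1..<n}. 1 / real k)"
    by (rule sum.reindex_bij_witness [where i = int and j = nat]) auto
  also have "\<dots> \<le> (\<Sum>k\<in>{1..n}. 1 / real k)" by (intro sum_mono2) auto
  also have "\<dots> \<le> 1 + ln (real n)"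
    using assms
  proof (induction n rule: dec_induct)
    case (step n)
    have "ln (real n / real (Suc n)) \<le> real n / real (Suc n) - 1"
      using step by (intro ln_le_minus_one) auto
    also have "\<dots> = - (1 / real (Suc n))" by (simp add: field_simps)
    finally have "1 / real (Suc n) \<le> ln (real (Suc n)) - ln (real n)"
      using step by (simp add: ln_div)
    then show ?case using step by simp
  qed simp
  finally show ?thesis .
qed

text \<open>Folds the second reciprocal in \<open>wt\<close> onto the first.\<close>

lemma sum_reflect:
  fixes f :: "int \<Rightarrow> 'a::comm_monoid_add"
  shows "(\<Sum>x\<in>{a..<b}. f (a + b - 1 - x)) = (\<Sum>x\<in>{a..<b}. f x)"
  by (rule sum.reindex_bij_witness [where i = "\<lambda>x. a + b - 1 - x" and j = "\<lambda>x. a + b - 1 - x"]) auto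

text \<open>Passing from modulus \<open>q * d\<close> to modulus \<open>d\<close> along a residue
  class costs only a logarithm: the two points nearest to a multiple of \<open>q * d\<close>
  dominate, and the others form harmonic sums.\<close>

lemma sum_wt_progression:
  assumes d: "d > 0" and q: "q \<ge> 1" and r: "\<not> d dvd r"
  shows "(\<Sum>l\<in>{0..<int q}. wt (int q * d) (r + l * d)) \<le> (2 + ln (real q)) * wt d r"
proof -
  define s where "s = r mod d"
  have s: "0 < s" "s < d" using mod_pos_of_not_dvd [OF d r] d by (simp_all add: s_def)
  \<comment> \<open>The term \<open>l = 0\<close> is kept apart, which turns \<open>1 + ln\<close>
    into \<open>2 + ln\<close>; for \<open>l \<ge> 1\<close> the denominator is at least
    \<open>l * t\<close>.\<close>
  have bound: "(\<Sum>l\<in>{0..<int q}. 1 / real_of_int (t + l * d)) \<le> (2 + ln (real q)) * (1 / of_int t)"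
    if t: "0 < t" "t < d" for t
  proof -
    have "{0..<int q} = insert 0 {1..<int q}" using q by auto
    then have "(\<Sum>l\<in>{0..<int q}. 1 / real_of_int (t + l * d))
        = 1 / of_int t + (\<Sum>l\<in>{1..<int q}. 1 / real_of_int (t + l * d))" by simp
    also have "(\<Sum>l\<in>{1..<int q}. 1 / real_of_int (t + l * d)) \<le> (\<Sum>l\<in>{1..<int q}. 1 / real_of_int l * (1 / of_int t))"
    proof (rule sum_mono)
      fix l assume l: "l \<in> {1..<int q}"
      then have "l * t \<le> l * d" using t by (intro mult_left_mono) auto
      then have "l * t \<le> t + l * d" using t by linarith
      then have "real_of_int l * of_int t \<le> real_of_int (t + l * d)" by (metis of_int_le_iff of_int_mult)
      then show "1 / real_of_int (t + l * d) \<le> 1 / real_of_int l * (1 / of_int t)"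
        using l t by (simp add: frac_le)
    qed
    also have "\<dots> \<le> (1 + ln (real q)) * (1 / of_int t)"
      unfolding sum_distrib_right [symmetric] using t q by (intro mult_right_mono sum_inverse_le) auto
    also have "1 / of_int t + (1 + ln (real q)) * (1 / of_int t) = (2 + ln (real q)) * (1 / of_int t)"
      by (simp add: algebra_simps)
    finally show ?thesis by simp
  qed
  have "(\<Sum>l\<in>{0..<int q}. wt (int q * d) (r + l * d)) = (\<Sum>l\<in>{0..<int q}. wt (int q * d) (s + l * d))"
  proof -
    let ?f = "\<lambda>l. wt (int q * d) (s + l * d)"
    have rs: "r = s + (r div d) * d" by (simp add: s_def)
    have "(\<Sum>l\<in>{0..<int q}. ?f (l + r div d)) = (\<Sum>l\<in>{0..<int q}. ?f l)"
    proof (rule sum_residues_shift)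
      fix l
      have "(int q * d) dvd (s + (l mod int q) * d) - (s + l * d)"
        using mod_eq_dvd_iff [of "l mod int q" "int q" l] by (auto simp: left_diff_distrib [symmetric])
      then show "?f (l mod int q) = ?f l" by (intro wt_cong) (simp add: mod_eq_dvd_iff)
    qed (use q in auto)
    moreover have "s + (l + r div d) * d = r + l * d" for l
      using rs by (simp add: distrib_right)
    ultimately show ?thesis by simp
  qed
  \<comment> \<open>The distance to \<open>q * d\<close> is written as a progression starting at
    \<open>d - s\<close> with index \<open>q - 1 - l\<close>, in the shape that
    \<open>sum_reflect\<close> expects.\<close>
  also have "\<dots> = (\<Sum>l\<in>{0..<int q}. 1 / real_of_int (s + l * d) + 1 / real_of_int ((d - s) + (0 + int q - 1 - l) * d))"
  proof (rule sum.cong [OF refl])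
    fix l assume l: "l \<in> {0..<int q}"
    then have "(l + 1) * d \<le> int q * d" using d by (intro mult_right_mono) auto
    then have b: "0 < s + l * d" "s + l * d < int q * d"
      using s l d by (auto simp: algebra_simps add_pos_nonneg)
    then have "\<not> int q * d dvd s + l * d" by (simp add: zdvd_not_zless)
    then show "wt (int q * d) (s + l * d)
        = 1 / real_of_int (s + l * d) + 1 / real_of_int ((d - s) + (0 + int q - 1 - l) * d)"
      using b by (simp add: wt_def algebra_simps)
  qed
  also have "\<dots> = (\<Sum>l\<in>{0..<int q}. 1 / real_of_int (s + l * d)) + (\<Sum>l\<in>{0..<int q}. 1 / real_of_int ((d - s) + l * d))"
    unfolding sum.distrib using sum_reflect [of "\<lambda>l. 1 / real_of_int ((d - s) + l * d)" 0 "int q"] by simp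
  also have "\<dots> \<le> (2 + ln (real q)) * (1 / of_int s) + (2 + ln (real q)) * (1 / of_int (d - s))"
    using s by (intro add_mono bound) auto
  also have "\<dots> = (2 + ln (real q)) * wt d r"
    using r unfolding wt_def s_def by (simp add: distrib_left)
  finally show ?thesis .
qed

lemma sum_wt:
  assumes "m \<ge> 1"
  shows "(\<Sum>x\<in>{0..<int m}. wt (int m) x) \<le> 2 * (1 + ln (real m))"
proof -
  have "{0..<int m} = insert 0 {1..<int m}" using assms by auto
  then have "(\<Sum>x\<in>{0..<int m}. wt (int m) x) = (\<Sum>x\<in>{1..<int m}. wt (int m) x)"
    by (simp add: wt_def)
  also have "\<dots> = (\<Sum>x\<in>{1..<int m}. 1 / of_int x + 1 / of_int (1 + int m - 1 - x))"
    by (intro sum.cong refl) (auto simp: wt_def zdvd_not_zless)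
  also have "\<dots> = 2 * (\<Sum>x\<in>{1..<int m}. 1 / real_of_int x)"
    unfolding sum.distrib using sum_reflect [of "\<lambda>l. 1 / real_of_int l" 1 "int m"] by simp
  finally show ?thesis using sum_inverse_le [OF assms] by simp
qed

lemma sum_periodic:
  fixes f :: "int \<Rightarrow> real"
  assumes per: "\<And>x. f (x mod d) = f x" and d: "d > 0" and q: "q > 0"
  shows "(\<Sum>x\<in>{0..<q * d}. f x) = of_int q * (\<Sum>x\<in>{0..<d}. f x)"
proof -
  have "f (r + l * d) = f r" for r l using per [of "r + l * d"] per [of r] by simp
  then show ?thesis using q by (simp add: sum_residues_split [OF d q] sum_distrib_left)
qed

text \<open>For \<open>g = gcd k m\<close> the summand has period \<open>m' = m / g\<close>. The
  \<open>g\<close> periods cancel the factor \<open>1 / g\<close> from \<open>wt_scale\<close>, and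
  the remaining dilation by \<open>k'\<close> permutes residues modulo \<open>m'\<close>.\<close>

lemma sum_wt_dilate:
  assumes m: "m \<ge> 1"
  shows "(\<Sum>a\<in>{0..<int m}. wt (int m) (a * k)) \<le> 2 * (1 + ln (real m))"
proof -
  define g where "g = gcd k (int m)"
  have g: "g > 0" "g \<noteq> 0" using m by (simp_all add: g_def)
  have "\<exists>k' m'. k = k' * g \<and> int m = m' * g \<and> coprime k' m'"
    unfolding g_def by (rule gcd_coprime_exists) (use g in \<open>simp add: g_def\<close>)
  then obtain k' m' where km: "k = k' * g" "int m = m' * g" "coprime k' m'" by blast
  have "0 < m' * g" using m by (simp flip: km(2))
  then have m': "m' > 0" using g by (simp add: zero_less_mult_iff)
  have "m' \<le> int m" using km(2) mult_left_mono [of 1 g m'] g m' by simp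
  have "(\<Sum>a\<in>{0..<int m}. wt (int m) (a * k)) = (\<Sum>a\<in>{0..<g * m'}. wt (g * m') (g * (k' * a)))"
    unfolding km(1,2) by (simp add: mult_ac)
  also have "\<dots> = of_int g * (\<Sum>a\<in>{0..<m'}. wt (g * m') (g * (k' * a)))"
  proof (rule sum_periodic)
    show "wt (g * m') (g * (k' * (x mod m'))) = wt (g * m') (g * (k' * x))" for x
      by (intro wt_cong) (simp add: mod_mult_right_eq)
  qed (use g m' in auto)
  also have "\<dots> = (\<Sum>a\<in>{0..<m'}. wt m' (k' * a))"
    using g m' by (simp add: sum_distrib_left wt_scale)
  also have "\<dots> = (\<Sum>a\<in>{0..<int (nat m')}. wt (int (nat m')) a)"
    using m' km(3) by (simp add: sum_residues_mult wt_mod)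
  also have "\<dots> \<le> 2 * (1 + ln (real (nat m')))"
    using m' by (intro sum_wt) simp
  also have "\<dots> \<le> 2 * (1 + ln (real m))"
    using m' \<open>m' \<le> int m\<close> by simp
  finally show ?thesis .
qed

text \<open>Concavity of sine gives \<open>2 * t \<le> sin (pi * t)\<close> up to
  \<open>t = 1 / 2\<close>. The product form is symmetric under \<open>y\<close> to
  \<open>1 - y\<close> and fits the two reciprocals in \<open>wt\<close>.\<close>

lemma sin_pi_ge:
  assumes "0 \<le> y" "y \<le> 1"
  shows "2 * y * (1 - y) \<le> sin (pi * y)"
proof -
  have convex: "convex_on {0..pi} (\<lambda>x. - sin x)"
    by (rule f''_ge0_imp_convex [where f' = "\<lambda>x. - cos x" and f'' = sin])
      (auto intro!: derivative_eq_intros simp: sin_ge_zero)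
  have half: "2 * t \<le> sin (pi * t)" if "0 \<le> t" "t \<le> 1 / 2" for t :: real
    using convex_onD [OF convex, of "2 * t" 0 "pi / 2"] that by (simp add: mult_ac)
  show ?thesis
  proof (cases "y \<le> 1 / 2")
    case True
    have "2 * y * (1 - y) \<le> 2 * y * 1" using assms by (intro mult_left_mono) auto
    then show ?thesis using half [of y] True assms by simp
  next
    case False
    have "2 * y * (1 - y) \<le> 2 * 1 * (1 - y)" using assms by (intro mult_right_mono) auto
    moreover have "sin (pi * (1 - y)) = sin (pi * y)" by (simp add: right_diff_distrib)
    ultimately show ?thesis using half [of "1 - y"] False assms by simp
  qed
qed

lemma inverse_norm_one_minus_ee_le:
  assumes m: "m > 0" and x: "\<not> m dvd x"
  shows "1 / cmod (1 - ee m x) \<le> of_int m * wt m x / 4"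
proof -
  define s where "s = x mod m"
  define y where "y = real_of_int s / of_int m"
  have s: "0 < s" "s < m" using mod_pos_of_not_dvd [OF m x] m by (simp_all add: s_def)
  have y: "0 < y" "y < 1" using s by (simp_all add: y_def)
  have sine: "0 \<le> sin (pi * y)" using y by (intro sin_ge_zero) auto
  have norm: "cmod (1 - ee m s) = 2 * \<bar>sin (pi * y)\<bar>" by (simp add: norm_one_minus_ee y_def)
  have "1 / cmod (1 - ee m x) = 1 / cmod (1 - ee m s)"
    using m by (simp add: s_def ee_mod)
  also have "\<dots> = 1 / (2 * sin (pi * y))"
    using sine norm by simp
  also have "\<dots> \<le> 1 / (4 * y * (1 - y))"
    using sin_pi_ge [of y] y by (intro frac_le) auto
  \<comment> \<open>Partial fractions:
    \<open>1 / (y * (1 - y)) = 1 / y + 1 / (1 - y)\<close>.\<close>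
  also have "\<dots> = of_int m * wt m x / 4"
    using s x unfolding wt_def y_def s_def [symmetric] by (simp add: field_simps)
  finally show ?thesis .
qed

section \<open>The sawtooth and its Fourier coefficients\<close>

lemma B1_add_of_int: "B1 (x + of_int n) = B1 x"
  by (simp add: B1_def)

lemma B1_mod:
  assumes "m > 0"
  shows "B1 (of_int (x mod m) / of_int m) = B1 (of_int x / of_int m)"
proof -
  have "real_of_int x = of_int (x mod m) + of_int (x div m) * of_int m"
    by (metis add.commute div_mult_mod_eq of_int_add of_int_mult)
  then have "real_of_int x / of_int m = of_int (x mod m) / of_int m + of_int (x div m)"
    using assms by (simp add: add_divide_distrib)
  then show ?thesis by (simp only: B1_add_of_int)
qed

lemma B1_fraction:
  assumes "0 < x" "x < m"
  shows "B1 (of_int x / of_int m) = of_int x / of_int m - 1 / 2"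
proof -
  have "0 < real_of_int x / of_int m" "real_of_int x / of_int m < 1" using assms by auto
  then have fl: "\<lfloor>real_of_int x / of_int m\<rfloor> = 0" by linarith
  then have "real_of_int x / of_int m \<notin> \<int>"
    using \<open>0 < real_of_int x / of_int m\<close> by (metis Ints_cases floor_of_int less_irrefl of_int_0)
  then show ?thesis by (simp add: B1_def fl)
qed

definition saw :: "int \<Rightarrow> int \<Rightarrow> complex" where
  "saw m x = of_real (B1 (of_int x / of_int m))"

lemma saw_mod: "m > 0 \<Longrightarrow> saw m (x mod m) = saw m x"
  by (simp add: saw_def B1_mod)

text \<open>Since \<open>B1\<close> is \<open>0\<close> at integers, its unit jump splits into two
  halves, one entering and one leaving \<open>0\<close>; \<open>m \<ge> 2\<close> keeps these two
  increments apart.\<close>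

lemma saw_diff:
  assumes m: "m \<ge> 2" and j: "j \<in> {0..<m}"
  shows "saw m j - saw m (j - 1) = 1 / of_int m - (if j = 0 then 1 / 2 else 0) - (if j = 1 then 1 / 2 else 0)"
proof -
  have 0: "saw m 0 = 0" by (simp add: saw_def B1_def)
  have pos: "saw m x = of_int x / of_int m - 1 / 2" if "0 < x" "x < m" for x
    using B1_fraction [OF that] by (simp add: saw_def)
  have "(- 1) mod m = m - 1" using m by (simp add: zmod_minus1)
  then have "saw m (- 1) = saw m (m - 1)" using saw_mod [of m "- 1"] m by simp
  also have "\<dots> = of_int (m - 1) / of_int m - 1 / 2" using m by (intro pos) auto
  finally have minus: "saw m (- 1) = 1 / 2 - 1 / of_int m" using m by (simp add: diff_divide_distrib)
  consider "j = 0" | "j = 1" | "j \<ge> 2" using j by fastforce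
  then show ?thesis
  proof cases
    case 3
    then show ?thesis using j m by (simp add: pos diff_divide_distrib)
  qed (use m 0 minus pos [of 1] in auto)
qed

text \<open>Summation by parts: the sawtooth has constant increments away from its jump.\<close>

lemma norm_dft_saw_le:
  assumes m: "m > 0" and k: "\<not> m dvd k"
  shows "cmod (dft m (saw m) k) \<le> of_int m * wt m k / 4"
proof -
  have m2: "m \<ge> 2" using m k by (cases "m = 1") auto
  have "(\<Sum>j\<in>{0..<m}. saw m (j - 1) * ee m (j * k)) = (\<Sum>j\<in>{0..<m}. saw m (j + 1 - 1) * ee m ((j + 1) * k))"
  proof (rule sum_residues_shift [symmetric])
    fix x
    have "saw m (x mod m - 1) = saw m (x - 1)"
      using m by (metis saw_mod mod_diff_left_eq)
    moreover have "ee m (x mod m * k) = ee m (x * k)"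
      using m by (metis ee_mod less_irrefl mod_mult_left_eq)
    ultimately show "saw m (x mod m - 1) * ee m (x mod m * k) = saw m (x - 1) * ee m (x * k)" by simp
  qed (fact m)
  also have "\<dots> = dft m (saw m) k * ee m k"
    by (simp add: dft_def distrib_right ee_add sum_distrib_right mult.assoc)
  finally have "dft m (saw m) k * (1 - ee m k)
      = (\<Sum>j\<in>{0..<m}. (saw m j - saw m (j - 1)) * ee m (j * k))"
    by (simp add: dft_def right_diff_distrib left_diff_distrib sum_subtractf)
  also have "\<dots> = (\<Sum>j\<in>{0..<m}. ee m (j * k) / of_int m - (if j = 0 then 1 / 2 else 0) - (if j = 1 then ee m k / 2 else 0))"
    by (intro sum.cong refl) (simp add: saw_diff [OF m2] left_diff_distrib)
  \<comment> \<open>The constant increments cancel by orthogonality as \<open>m\<close> does not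
    divide \<open>k\<close>; only the half-jumps remain.\<close>
  also have "\<dots> = - (1 + ee m k) / 2"
    using m2 k by (simp add: sum_subtractf sum_divide_distrib [symmetric] sum_ee)
  finally have eq: "dft m (saw m) k * (1 - ee m k) = - (1 + ee m k) / 2" .
  have "cmod (dft m (saw m) k) * cmod (1 - ee m k) \<le> 1"
    using norm_triangle_ineq [of 1 "ee m k"]
    by (simp only: norm_mult [symmetric] eq norm_divide norm_minus_cancel) simp
  moreover have "cmod (1 - ee m k) > 0" using ee_eq_1_iff [OF m, of k] k by simp
  ultimately have "cmod (dft m (saw m) k) \<le> 1 / cmod (1 - ee m k)"
    by (simp add: pos_le_divide_eq)
  also have "\<dots> \<le> of_int m * wt m k / 4" by (rule inverse_norm_one_minus_ee_le [OF m k])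
  finally show ?thesis .
qed

text \<open>Expanding the character by Fourier inversion makes this an average of sawtooth
  coefficients at the frequencies \<open>k - l * d\<close>, weighted by Gauss sums. These
  frequencies form a residue class modulo \<open>d\<close>.\<close>

lemma norm_dft_char_saw_le:
  assumes prim: "primitive_character q \<psi>" and d: "d > 0" and k: "\<not> d dvd k"
  shows "cmod (dft (int q * d) (\<lambda>j. cnj (\<psi> j) * saw (int q * d) j) k)
    \<le> sqrt (real q) * of_int d / 4 * ((2 + ln (real q)) * wt d k)"
proof -
  have chi: "dirichlet_character q \<psi>" using prim by (simp add: primitive_character_def)
  note q = modulus_pos [OF chi]
  let ?c = "int q * d"
  define G where "G = dft (int q) (\<lambda>n. cnj (\<psi> n))"
  have c: "?c > 0" using q d by simp
  have chi_eq: "cnj (\<psi> j) = (\<Sum>l\<in>{0..<int q}. G l * ee ?c (j * - (l * d))) / of_int (int q)" for j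
  proof -
    have "ee (int q) (- (l * j)) = ee ?c (j * - (l * d))" for l
      using ee_cancel [of d "int q" "- (l * j)"] d by (simp add: mult_ac)
    then show ?thesis
      using dft_inverse [of "\<lambda>n. cnj (\<psi> n)" "int q" j] char_mod [OF chi] q by (simp add: G_def)
  qed
  have e: "ee ?c (j * - (l * d)) * ee ?c (j * k) = ee ?c (j * (k - l * d))" for j l
    by (simp add: ee_add [symmetric] algebra_simps)
  have "cnj (\<psi> j) * saw ?c j * ee ?c (j * k)
      = (\<Sum>l\<in>{0..<int q}. G l * (saw ?c j * ee ?c (j * (k - l * d)))) / of_int (int q)" for j
    unfolding chi_eq times_divide_eq_left sum_distrib_right e [symmetric] by (simp only: mult_ac)
  then have "dft ?c (\<lambda>j. cnj (\<psi> j) * saw ?c j) k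
      = (\<Sum>j\<in>{0..<?c}. \<Sum>l\<in>{0..<int q}. G l * (saw ?c j * ee ?c (j * (k - l * d)))) / of_int (int q)"
    by (simp only: dft_def [of ?c] sum_divide_distrib)
  also have "\<dots> = (\<Sum>l\<in>{0..<int q}. G l * dft ?c (saw ?c) (k - l * d)) / of_int (int q)"
    by (subst sum.swap) (simp add: dft_def [of ?c] sum_distrib_left)
  finally have "cmod (dft ?c (\<lambda>j. cnj (\<psi> j) * saw ?c j) k)
      = cmod (\<Sum>l\<in>{0..<int q}. G l * dft ?c (saw ?c) (k - l * d)) / real q"
    by (simp add: norm_divide)
  also have "\<dots> \<le> (\<Sum>l\<in>{0..<int q}. sqrt (real q) * (of_int ?c * wt ?c (- k + l * d) / 4)) / real q"
  proof (intro divide_right_mono sum_norm_le)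
    fix l
    have "\<not> ?c dvd k - l * d"
    proof
      assume "?c dvd k - l * d"
      then have "d dvd (k - l * d) + l * d" by (intro dvd_add) (auto elim: dvd_mult_right)
      then show False using k by simp
    qed
    \<comment> \<open>Evenness of \<open>wt\<close> turns the decreasing progression into the
      increasing one of \<open>sum_wt_progression\<close>.\<close>
    moreover have "wt ?c (- k + l * d) = wt ?c (k - l * d)"
      using wt_uminus [of ?c "k - l * d"] by simp
    ultimately show "cmod (G l * dft ?c (saw ?c) (k - l * d)) \<le> sqrt (real q) * (of_int ?c * wt ?c (- k + l * d) / 4)"
      using norm_dft_saw_le [OF c, of "k - l * d"] unfolding norm_mult
      by (intro mult_mono) (simp_all add: G_def norm_dft_primitive_char [OF prim])
  qed simp
  also have "\<dots> = sqrt (real q) * of_int d / 4 * (\<Sum>l\<in>{0..<int q}. wt ?c (- k + l * d))"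
    unfolding sum_divide_distrib sum_distrib_left using q
    by (intro sum.cong refl) (simp add: field_simps)
  also have "\<dots> \<le> sqrt (real q) * of_int d / 4 * ((2 + ln (real q)) * wt d k)"
    using sum_wt_progression [OF d, of q "- k"] q k d
    by (intro mult_left_mono) (auto simp: wt_uminus)
  finally show ?thesis .
qed

section \<open>The second moment\<close>

text \<open>With \<open>c = q1 * e\<close> the second argument of \<open>B1\<close> is
  \<open>(n * e + a * j) / c\<close>. Fourier inversion of that factor separates \<open>n\<close>
  from \<open>j\<close>.\<close>

lemma dedekind_sum_spectral:
  assumes chi1: "dirichlet_character q1 \<psi>1" and c: "c > 0" and q1: "q1 dvd c"
  shows "dedekind_sum q1 \<psi>1 \<psi>2 a c =
    (\<Sum>k\<in>{0..<int c}. dft (int c) (saw (int c)) k * dft (int q1) (\<lambda>n. cnj (\<psi>1 n)) (- k)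
       * dft (int c) (\<lambda>j. cnj (\<psi>2 j) * saw (int c) j) (- (a * k))) / of_nat c"
proof -
  let ?c = "int c"
  define D where "D = dft ?c (saw ?c)"
  obtain e where e: "c = q1 * e" using q1 by auto
  have pos: "q1 > 0" "e > 0" using c e by (auto intro: Nat.gr0I)
  have saw_eq: "complex_of_real (B1 (of_int n / of_nat q1 + of_int (a * j) / of_nat c))
      = (\<Sum>k\<in>{0..<?c}. D k * (ee (int q1) (n * - k) * ee ?c (j * - (a * k)))) / of_nat c" for n j
  proof -
    have ee_eq: "ee ?c (- (k * (n * int e + a * j))) = ee (int q1) (n * - k) * ee ?c (j * - (a * k))" for k
    proof -
      have "ee (int q1) (n * - k) = ee ?c (int e * (n * - k))"
        using ee_cancel [of "int e" "int q1" "n * - k"] pos by (simp add: e mult_ac)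
      then show ?thesis by (simp add: ee_add [symmetric] algebra_simps)
    qed
    have "real_of_int n / of_nat q1 + of_int (a * j) / of_nat c = of_int (n * int e + a * j) / of_int ?c"
      using pos by (simp add: e field_simps)
    then have "complex_of_real (B1 (of_int n / of_nat q1 + of_int (a * j) / of_nat c)) = saw ?c (n * int e + a * j)"
      by (simp only: saw_def)
    also have "\<dots> = (\<Sum>k\<in>{0..<?c}. D k * ee ?c (- (k * (n * int e + a * j)))) / of_nat c"
      unfolding D_def using dft_inverse [of "saw ?c" ?c "n * int e + a * j"] saw_mod c by simp
    also have "\<dots> = (\<Sum>k\<in>{0..<?c}. D k * (ee (int q1) (n * - k) * ee ?c (j * - (a * k)))) / of_nat c"
      by (simp only: ee_eq)
    finally show ?thesis .
  qed
  have term_eq: "cnj (\<psi>2 j) * cnj (\<psi>1 n) * of_real (B1 (of_int j / of_nat c)) *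
        of_real (B1 (of_int n / of_nat q1 + of_int (a * j) / of_nat c))
      = (\<Sum>k\<in>{0..<?c}. D k * ((cnj (\<psi>1 n) * ee (int q1) (n * - k))
          * (cnj (\<psi>2 j) * saw ?c j * ee ?c (j * - (a * k))))) / of_nat c" for j n
    unfolding saw_eq times_divide_eq_right sum_distrib_left saw_def of_int_of_nat_eq
    by (simp only: mult_ac)
  have "dedekind_sum q1 \<psi>1 \<psi>2 a c = (\<Sum>j\<in>{0..<?c}. \<Sum>n\<in>{0..<int q1}. \<Sum>k\<in>{0..<?c}.
      D k * ((cnj (\<psi>1 n) * ee (int q1) (n * - k)) * (cnj (\<psi>2 j) * saw ?c j * ee ?c (j * - (a * k))))) / of_nat c"
    unfolding dedekind_sum_def term_eq sum_divide_distrib [symmetric] ..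
  also have "(\<Sum>j\<in>{0..<?c}. \<Sum>n\<in>{0..<int q1}. \<Sum>k\<in>{0..<?c}.
      D k * ((cnj (\<psi>1 n) * ee (int q1) (n * - k)) * (cnj (\<psi>2 j) * saw ?c j * ee ?c (j * - (a * k)))))
    = (\<Sum>j\<in>{0..<?c}. \<Sum>k\<in>{0..<?c}. D k * (dft (int q1) (\<lambda>n. cnj (\<psi>1 n)) (- k) * (cnj (\<psi>2 j) * saw ?c j * ee ?c (j * - (a * k)))))"
    \<comment> \<open>Only the two inner sums are exchanged, so that the sum over \<open>n\<close>
      becomes a Gauss sum.\<close>
    by (subst sum.swap [of _ "{0..<?c}" "{0..<int q1}"]) (simp only: dft_def [of "int q1"] sum_distrib_left sum_distrib_right)
  also have "\<dots> = (\<Sum>k\<in>{0..<?c}. D k * dft (int q1) (\<lambda>n. cnj (\<psi>1 n)) (- k)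
       * dft ?c (\<lambda>j. cnj (\<psi>2 j) * saw ?c j) (- (a * k)))"
    by (subst sum.swap) (simp only: dft_def [of ?c "\<lambda>j. cnj (\<psi>2 j) * saw ?c j"] sum_distrib_left mult.assoc)
  finally show ?thesis unfolding D_def .
qed

text \<open>The quantity \<open>T(a)\<close> of the introductory sketch, with \<open>wt\<close> in
  place of the reciprocal distance.\<close>

definition wt_corr :: "int \<Rightarrow> int \<Rightarrow> real" where
  "wt_corr d a = (\<Sum>r\<in>{0..<d}. wt d r * wt d (a * r))"

lemma wt_corr_nonneg: "d > 0 \<Longrightarrow> 0 \<le> wt_corr d a"
  unfolding wt_corr_def by (intro sum_nonneg mult_nonneg_nonneg wt_nonneg)

lemma wt_corr_le:
  assumes "d \<ge> 1"
  shows "wt_corr (int d) a \<le> 4 * (1 + ln (real d))"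
proof -
  have "wt_corr (int d) a \<le> (\<Sum>r\<in>{0..<int d}. wt (int d) r * 2)"
    unfolding wt_corr_def using assms by (intro sum_mono mult_left_mono wt_le_2 wt_nonneg) auto
  then show ?thesis using sum_wt [OF assms] by (simp add: sum_distrib_right [symmetric])
qed

text \<open>Summing over \<open>a\<close> first, for fixed \<open>r\<close>, gives a bound uniform
  in \<open>r\<close> by \<open>sum_wt_dilate\<close>.\<close>

lemma sum_wt_corr_le:
  assumes d: "d \<ge> 1" and q: "q \<ge> 1"
  shows "(\<Sum>a\<in>{0..<int q * int d}. wt_corr (int d) a) \<le> real q * (2 * (1 + ln (real d)))\<^sup>2"
proof -
  let ?L = "2 * (1 + ln (real d))"
  have per: "wt_corr (int d) (a mod int d) = wt_corr (int d) a" for a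
    unfolding wt_corr_def
    by (intro sum.cong refl arg_cong2 [where f = "(*)"] wt_cong) (simp add: mod_mult_left_eq)
  have "(\<Sum>a\<in>{0..<int q * int d}. wt_corr (int d) a) = real q * (\<Sum>a\<in>{0..<int d}. wt_corr (int d) a)"
    using sum_periodic [of "wt_corr (int d)" "int d" "int q"] per d q by simp
  also have "(\<Sum>a\<in>{0..<int d}. wt_corr (int d) a)
      = (\<Sum>r\<in>{0..<int d}. wt (int d) r * (\<Sum>a\<in>{0..<int d}. wt (int d) (a * r)))"
    unfolding wt_corr_def by (subst sum.swap) (simp add: sum_distrib_left)
  also have "\<dots> \<le> (\<Sum>r\<in>{0..<int d}. wt (int d) r * ?L)"
    using d by (intro sum_mono mult_left_mono sum_wt_dilate wt_nonneg) auto
  also have "\<dots> \<le> ?L * ?L"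
    unfolding sum_distrib_right [symmetric] using d by (intro mult_right_mono sum_wt) auto
  finally show ?thesis using q by (simp add: power2_eq_square mult_left_mono)
qed

text \<open>Frequencies divisible by \<open>d\<close> vanish because \<open>q1\<close> divides
  \<open>d\<close> and the first character is nontrivial. For the others \<open>d\<close> does not
  divide \<open>a * k\<close> either, so both decay bounds apply.\<close>

lemma norm_dedekind_sum_le:
  assumes prim1: "primitive_character q1 \<psi>1" and nontriv1: "nontrivial_character q1 \<psi>1"
    and prim2: "primitive_character q2 \<psi>2"
    and d: "d \<ge> 1" and q1: "q1 dvd d" and c: "c = q2 * d" and a: "coprime a (int c)"
  shows "cmod (dedekind_sum q1 \<psi>1 \<psi>2 a c)
    \<le> sqrt (real q1) * sqrt (real q2) * real d / 16 * (2 + ln (real q2))\<^sup>2 * wt_corr (int d) a"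
proof -
  have chi1: "dirichlet_character q1 \<psi>1" and chi2: "dirichlet_character q2 \<psi>2"
    using prim1 prim2 by (simp_all add: primitive_character_def)
  have q2: "q2 \<ge> 1" using modulus_pos [OF chi2] by simp
  have c0: "c > 0" and q1c: "q1 dvd c" using c q2 d q1 by auto
  let ?c = "int c" and ?d = "int d" and ?L = "2 + ln (real q2)"
  let ?f = "\<lambda>k. dft ?c (saw ?c) k * dft (int q1) (\<lambda>n. cnj (\<psi>1 n)) (- k)
       * dft ?c (\<lambda>j. cnj (\<psi>2 j) * saw ?c j) (- (a * k))"
  let ?A = "sqrt (real q1) * sqrt (real q2) * real d * real c / 16 * ?L"
  have cd: "?c = int q2 * ?d" by (simp add: c)
  have L: "?L \<ge> 0" using q2 by simp
  have ad: "coprime a ?d" using a by (simp add: c)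
  have f_le: "cmod (?f k) \<le> ?A * (wt ?c k * wt ?d (a * k))" for k
  proof (cases "?d dvd k")
    case True
    then have "int q1 dvd - k" using q1 by (metis dvd_minus_iff dvd_trans int_dvd_int_iff)
    then have "?f k = 0" by (simp add: dft_nontrivial_char_0 [OF chi1 nontriv1])
    then show ?thesis using c0 d L by (simp only: norm_zero) (intro mult_nonneg_nonneg wt_nonneg; simp)
  next
    case False
    then have "\<not> ?c dvd k" unfolding cd by (metis dvd_mult_right)
    then have 1: "cmod (dft ?c (saw ?c) k) \<le> real c * wt ?c k / 4"
      using norm_dft_saw_le [of ?c k] c0 by simp
    have "\<not> ?d dvd - (a * k)"
      using False ad by (simp add: coprime_dvd_mult_right_iff coprime_commute)
    then have 2: "cmod (dft ?c (\<lambda>j. cnj (\<psi>2 j) * saw ?c j) (- (a * k))) \<le> sqrt (real q2) * real d / 4 * (?L * wt ?d (a * k))"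
      using norm_dft_char_saw_le [OF prim2, of ?d "- (a * k)"] d unfolding cd by (simp add: wt_uminus)
    have "cmod (?f k) \<le> (real c * wt ?c k / 4 * sqrt (real q1)) * (sqrt (real q2) * real d / 4 * (?L * wt ?d (a * k)))"
      unfolding norm_mult using 1 2 norm_dft_primitive_char [OF prim1, of "- k"] c0
      by (intro mult_mono) (simp_all add: wt_nonneg)
    then show ?thesis by (simp add: mult_ac)
  qed
  \<comment> \<open>The second weight depends only on \<open>k\<close> modulo \<open>d\<close>, so
    the first can be summed over each class; this produces the second logarithm.\<close>
  have "(\<Sum>k\<in>{0..<?c}. wt ?c k * wt ?d (a * k))
      = (\<Sum>r\<in>{0..<?d}. (\<Sum>l\<in>{0..<int q2}. wt ?c (r + l * ?d)) * wt ?d (a * r))"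
  proof -
    have "wt ?d (a * (r + l * ?d)) = wt ?d (a * r)" for r l
      by (intro wt_cong) (simp add: distrib_left mult.assoc [symmetric])
    then show ?thesis
      unfolding cd using d q2 by (subst sum_residues_split) (simp_all add: sum_distrib_right)
  qed
  also have "\<dots> \<le> (\<Sum>r\<in>{0..<?d}. ?L * wt ?d r * wt ?d (a * r))"
  proof (rule sum_mono)
    fix r
    show "(\<Sum>l\<in>{0..<int q2}. wt ?c (r + l * ?d)) * wt ?d (a * r) \<le> ?L * wt ?d r * wt ?d (a * r)"
    proof (cases "?d dvd r")
      case True
      then show ?thesis by (simp add: wt_def)
    next
      case False
      then show ?thesis
        using d q2 unfolding cd by (intro mult_right_mono sum_wt_progression wt_nonneg) auto
    qed
  qed
  also have "\<dots> = ?L * wt_corr ?d a"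
    by (simp add: wt_corr_def sum_distrib_left mult.assoc)
  finally have corr: "(\<Sum>k\<in>{0..<?c}. wt ?c k * wt ?d (a * k)) \<le> ?L * wt_corr ?d a" .
  have "cmod (dedekind_sum q1 \<psi>1 \<psi>2 a c) = cmod (\<Sum>k\<in>{0..<?c}. ?f k) / real c"
    unfolding dedekind_sum_spectral [OF chi1 c0 q1c] by (simp add: norm_divide)
  also have "\<dots> \<le> (\<Sum>k\<in>{0..<?c}. ?A * (wt ?c k * wt ?d (a * k))) / real c"
    by (intro divide_right_mono sum_norm_le f_le) simp
  also have "\<dots> = ?A * (\<Sum>k\<in>{0..<?c}. wt ?c k * wt ?d (a * k)) / real c"
    by (simp only: sum_distrib_left)
  also have "\<dots> \<le> ?A * (?L * wt_corr ?d a) / real c"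
    using corr L by (intro divide_right_mono mult_left_mono) simp_all
  also have "\<dots> = sqrt (real q1) * sqrt (real q2) * real d / 16 * ?L\<^sup>2 * wt_corr ?d a"
    using c0 by (simp add: power2_eq_square)
  finally show ?thesis .
qed

text \<open>One factor of the squared correlation is bounded pointwise and the other on average. The
  powers of the logarithm add up as \<open>4 + 1 + 2 = 7\<close>.\<close>

lemma second_moment_le:
  assumes prim1: "primitive_character q1 \<psi>1" and nontriv1: "nontrivial_character q1 \<psi>1"
    and prim2: "primitive_character q2 \<psi>2"
    and c: "c > 0" and dvd: "q1 * q2 dvd c"
  shows "(\<Sum>a\<in>{a\<in>{0..<int c}. coprime a (int c)}. (cmod (dedekind_sum q1 \<psi>1 \<psi>2 a c))\<^sup>2)
    \<le> real q1 * (real c)\<^sup>2 * (2 + ln (real c)) ^ 7 / 16"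
proof -
  obtain e where "c = q1 * q2 * e" using dvd by auto
  then obtain d where cd: "c = q2 * d" and q1: "q1 dvd d"
    by (metis dvd_triv_left mult.assoc mult.commute)
  have d: "d \<ge> 1" and q2: "q2 \<ge> 1" using c cd by (auto simp: Suc_le_eq intro: Nat.gr0I)
  let ?L = "2 + ln (real c)" and ?T = "wt_corr (int d)"
  let ?B = "real q1 * real q2 * (real d)\<^sup>2 / 64 * ?L ^ 5"
  have "d \<le> c" "q2 \<le> c" using cd d q2 by auto
  then have ln_d: "ln (real d) \<le> ln (real c)" and ln_q2: "ln (real q2) \<le> ln (real c)"
    using d q2 by auto
  have L: "?L \<ge> 2" using c by simp
  have T0: "?T a \<ge> 0" for a using d by (intro wt_corr_nonneg) simp
  have T: "?T a \<le> 4 * ?L" for a using wt_corr_le [OF d, of a] ln_d by simp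
  have each: "(cmod (dedekind_sum q1 \<psi>1 \<psi>2 a c))\<^sup>2 \<le> ?B * ?T a" if "coprime a (int c)" for a
  proof -
    have "cmod (dedekind_sum q1 \<psi>1 \<psi>2 a c)
        \<le> sqrt (real q1) * sqrt (real q2) * real d / 16 * (2 + ln (real q2))\<^sup>2 * ?T a"
      by (rule norm_dedekind_sum_le [OF prim1 nontriv1 prim2 d q1 cd that])
    also have "\<dots> \<le> sqrt (real q1) * sqrt (real q2) * real d / 16 * ?L\<^sup>2 * ?T a"
      using ln_q2 q2 T0 by (intro mult_right_mono mult_left_mono power_mono) auto
    finally have "(cmod (dedekind_sum q1 \<psi>1 \<psi>2 a c))\<^sup>2
        \<le> (sqrt (real q1) * sqrt (real q2) * real d / 16 * ?L\<^sup>2 * ?T a)\<^sup>2"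
      by (intro power_mono) auto
    also have "\<dots> = real q1 * real q2 * (real d)\<^sup>2 / 256 * ?L ^ 4 * (?T a)\<^sup>2"
      by (simp add: power_mult_distrib power_divide flip: power_mult)
    also have "\<dots> = real q1 * real q2 * (real d)\<^sup>2 / 256 * ?L ^ 4 * (?T a * ?T a)"
      by (simp only: power2_eq_square)
    \<comment> \<open>Only one copy of \<open>?T a\<close> is estimated; the other is kept for the
      sum over \<open>a\<close>.\<close>
    also have "\<dots> \<le> real q1 * real q2 * (real d)\<^sup>2 / 256 * ?L ^ 4 * (4 * ?L * ?T a)"
      using T T0 L by (intro mult_left_mono mult_right_mono) auto
    also have "\<dots> = ?B * ?T a" by (simp add: eval_nat_numeral)
    finally show ?thesis .
  qed
  have B: "?B \<ge> 0" using L by simp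
  have "(\<Sum>a\<in>{a\<in>{0..<int c}. coprime a (int c)}. (cmod (dedekind_sum q1 \<psi>1 \<psi>2 a c))\<^sup>2)
      \<le> (\<Sum>a\<in>{a\<in>{0..<int c}. coprime a (int c)}. ?B * ?T a)"
    by (intro sum_mono each) auto
  also have "\<dots> \<le> (\<Sum>a\<in>{0..<int c}. ?B * ?T a)"
    using B T0 by (intro sum_mono2 mult_nonneg_nonneg) auto
  also have "\<dots> = ?B * (\<Sum>a\<in>{0..<int q2 * int d}. ?T a)"
    by (simp add: sum_distrib_left cd)
  also have "\<dots> \<le> ?B * (real q2 * (2 * ?L)\<^sup>2)"
  proof (rule mult_left_mono [OF _ B])
    have "(\<Sum>a\<in>{0..<int q2 * int d}. ?T a) \<le> real q2 * (2 * (1 + ln (real d)))\<^sup>2"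
      by (rule sum_wt_corr_le [OF d q2])
    also have "\<dots> \<le> real q2 * (2 * ?L)\<^sup>2"
      using ln_d d by (intro mult_left_mono power_mono) auto
    finally show "(\<Sum>a\<in>{0..<int q2 * int d}. ?T a) \<le> real q2 * (2 * ?L)\<^sup>2" .
  qed
  also have "\<dots> = real q1 * (real c)\<^sup>2 * ?L ^ 7 / 16"
  proof -
    have "x * y * z\<^sup>2 / 64 * l ^ 5 * (y * (2 * l)\<^sup>2) = x * (y * z)\<^sup>2 * l ^ 7 / 16" for x y z l :: real
      by (simp add: eval_nat_numeral)
    then show ?thesis by (simp only: cd of_nat_mult)
  qed
  finally show ?thesis .
qed

text \<open>Each of the \<open>n\<close> factors is absorbed by
  \<open>x powr (\<epsilon> / n)\<close>, using
  \<open>ln x \<le> x powr \<delta> / \<delta>\<close>.\<close>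

lemma ln_power_le_powr:
  assumes "\<epsilon> > 0" "n > 0" "x \<ge> 1"
  shows "(2 + ln x) ^ n \<le> (2 + real n / \<epsilon>) ^ n * x powr \<epsilon>"
proof -
  define \<delta> where "\<delta> = \<epsilon> / real n"
  have \<delta>: "\<delta> > 0" using assms by (simp add: \<delta>_def)
  have "1 \<le> x powr \<delta>" using assms \<delta> by (simp add: ge_one_powr_ge_zero)
  then have "2 + ln x \<le> 2 * x powr \<delta> + x powr \<delta> / \<delta>"
    using ln_powr_bound [of x \<delta>] assms \<delta> by linarith
  also have "\<dots> = (2 + real n / \<epsilon>) * x powr \<delta>"
    using assms by (simp add: \<delta>_def field_simps)
  finally have "(2 + ln x) ^ n \<le> ((2 + real n / \<epsilon>) * x powr \<delta>) ^ n"
    using assms by (intro power_mono) auto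
  also have "\<dots> = (2 + real n / \<epsilon>) ^ n * x powr \<epsilon>"
    using assms by (simp add: power_mult_distrib powr_power \<delta>_def)
  finally show ?thesis .
qed

theorem theorem4p1:
  fixes \<epsilon> :: real
  assumes "\<epsilon> > 0"
  shows "\<exists>K::real. \<forall>(q1::nat) (q2::nat) (\<chi>1 :: int \<Rightarrow> complex) (\<chi>2 :: int \<Rightarrow> complex) (c::nat).
           primitive_character q1 \<chi>1 \<longrightarrow> nontrivial_character q1 \<chi>1 \<longrightarrow>
           primitive_character q2 \<chi>2 \<longrightarrow> nontrivial_character q2 \<chi>2 \<longrightarrow>
           \<chi>1 (-1) * \<chi>2 (-1) = 1 \<longrightarrow>
           c > 0 \<longrightarrow> q1 * q2 dvd c \<longrightarrow>
           (\<Sum>a\<in>{a\<in>{0..<int c}. coprime a (int c)}. (cmod (dedekind_sum q1 \<chi>1 \<chi>2 a c))\<^sup>2)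
             \<le> K * real q1 * real c powr (2 + \<epsilon>)"
proof (intro exI [of _ "(2 + 7 / \<epsilon>) ^ 7 / 16"] allI impI)
  fix q1 q2 c :: nat and \<chi>1 \<chi>2 :: "int \<Rightarrow> complex"
  assume "primitive_character q1 \<chi>1" "nontrivial_character q1 \<chi>1" "primitive_character q2 \<chi>2"
    and c: "c > 0" and "q1 * q2 dvd c"
  then have "(\<Sum>a\<in>{a\<in>{0..<int c}. coprime a (int c)}. (cmod (dedekind_sum q1 \<chi>1 \<chi>2 a c))\<^sup>2)
      \<le> real q1 * (real c)\<^sup>2 * (2 + ln (real c)) ^ 7 / 16"
    by (intro second_moment_le)
  \<comment> \<open>Absorbing the seven logarithms yields the constant, which depends on
    \<open>\<epsilon>\<close> alone.\<close>
  also have "\<dots> \<le> real q1 * (real c)\<^sup>2 * ((2 + real 7 / \<epsilon>) ^ 7 * real c powr \<epsilon>) / 16"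
    using c assms by (intro divide_right_mono mult_left_mono ln_power_le_powr) auto
  also have "\<dots> = (2 + 7 / \<epsilon>) ^ 7 / 16 * real q1 * real c powr (2 + \<epsilon>)"
    using c by (simp add: powr_add)
  finally show "(\<Sum>a\<in>{a\<in>{0..<int c}. coprime a (int c)}. (cmod (dedekind_sum q1 \<chi>1 \<chi>2 a c))\<^sup>2)
      \<le> (2 + 7 / \<epsilon>) ^ 7 / 16 * real q1 * real c powr (2 + \<epsilon>)" .
qed

end
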